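(* Let $d\ge 2$ be an integer. For each $F\in\{K_{1,d+1},\,S_{2,d*1}\}$ and every integer $n\ge|V(F)|$, $$\mathrm{ex}_b(n,F)=\mathrm{ex}_{b,c}(n,F)=dn,$$ so that $\mathrm{ex}_b(n,K_{1,d+1})=\mathrm{ex}_{b,c}(n,K_{1,d+1})=\mathrm{ex}_b(n,S_{2,d*1})=\mathrm{ex}_{b,c}(n,S_{2,d*1})=dn$. For the case $d=1$ (where $K_{1,2}\cong P_3$ and $S_{2,1}\cong P_4$) and every $n\ge 2$: $\mathrm{ex}_b(n,P_3)=n$ and $\mathrm{ex}_b(n,P_4)=2n-2$, while $\mathrm{ex}_{b,c}(n,P_3)$ and $\mathrm{ex}_{b,c}(n,P_4)$ are not defined, i.e. there is no $P_3$-free and no $P_4$-free connected bipartite graph with both parts of size $n$.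
   Context: All graphs are finite and simple. A graph is $F$-free if it has no (not necessarily induced) subgraph isomorphic to $F$. $\mathrm{ex}_b(n,F)$ is the largest number of edges of an $F$-free bipartite graph with both parts of size $n$; $\mathrm{ex}_{b,c}(n,F)$ is the largest number of edges of an $F$-free connected bipartite graph with both parts of size $n$. $P_k$ is the path on $k$ vertices. $S_{2,d*1}$ is the tree on $d+3$ vertices obtained from one path with $2$ edges and $d$ paths with $1$ edge by identifying one endpoint of all these paths (equivalently, the star $K_{1,d+1}$ with one extra leaf attached to one of its leaves). *)

theory Defs
  imports "Graph_Theory.Graph_Theory"
begin

text \<open>
  A finite simple graph is a \<^locale>\<open>pair_graph\<close>: a finite vertex set with a symmetric irreflexive
  set of arcs, so that each undirected edge is represented by two arcs.
\<close>

definition edges :: "'a pair_pre_digraph \<Rightarrow> 'a set set" where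
  "edges G = (\<lambda>(u, v). {u, v}) ` parcs G"

definition contains_copy :: "'f pair_pre_digraph \<Rightarrow> 'a pair_pre_digraph \<Rightarrow> bool" where
  "contains_copy F G \<longleftrightarrow>
     (\<exists>H :: 'a pair_pre_digraph. subgraph (with_proj H) (with_proj G)
        \<and> digraph_iso (with_proj F) (with_proj H))"

definition balanced_bipartite :: "nat \<Rightarrow> 'a pair_pre_digraph \<Rightarrow> bool" where
  "balanced_bipartite n G \<longleftrightarrow> pair_graph G \<and>
     (\<exists>X Y. pverts G = X \<union> Y \<and> X \<inter> Y = {} \<and> card X = n \<and> card Y = n
        \<and> parcs G \<subseteq> X \<times> Y \<union> Y \<times> X)"

definition conn :: "'a pair_pre_digraph \<Rightarrow> bool" where
  "conn G \<longleftrightarrow> Digraph_Component.connected (with_proj G)"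

text \<open>
  The largest number of edges in a class of graphs; \<^term>\<open>None\<close> (undefined) if the class is empty.
  Taking vertices in \<^typ>\<open>nat\<close> loses nothing, as every finite graph has an isomorphic copy there.
  Below, the edge counts are at most n * n, so that \<^const>\<open>Max\<close> is taken over a finite set.
\<close>

definition max_edges :: "nat pair_pre_digraph set \<Rightarrow> nat option" where
  "max_edges \<G> = (if \<G> = {} then None else Some (Max ((\<lambda>G. card (edges G)) ` \<G>)))"

definition ex_b :: "nat \<Rightarrow> 'f pair_pre_digraph \<Rightarrow> nat option" where
  "ex_b n F = max_edges {G. balanced_bipartite n G \<and> \<not> contains_copy F G}"

definition ex_bc :: "nat \<Rightarrow> 'f pair_pre_digraph \<Rightarrow> nat option" where
  "ex_bc n F = max_edges {G. balanced_bipartite n G \<and> conn G \<and> \<not> contains_copy F G}"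

definition sym_graph :: "'a set \<Rightarrow> ('a \<times> 'a) set \<Rightarrow> 'a pair_pre_digraph" where
  "sym_graph V A = \<lparr> pverts = V, parcs = A \<union> A\<inverse> \<rparr>"

text \<open>\<open>P\<^sub>k\<close>, on k vertices\<close>
definition path_graph :: "nat \<Rightarrow> nat pair_pre_digraph" where
  "path_graph k = sym_graph {..<k} {(i, Suc i) | i. Suc i < k}"

text \<open>\<open>K\<^sub>1\<^sub>,\<^sub>m\<close>, with centre 0\<close>
definition star_graph :: "nat \<Rightarrow> nat pair_pre_digraph" where
  "star_graph m = sym_graph {..m} {(0, i) | i. 1 \<le> i \<and> i \<le> m}"

text \<open>\<open>S\<close> with parameters \<open>2, d * 1\<close>: the path 0 - 1 - 2 and the d edges from 0 to 3, ..., d + 2,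
  identified at 0\<close>
definition spider_graph :: "nat \<Rightarrow> nat pair_pre_digraph" where
  "spider_graph d = sym_graph {..d + 2} ({(0, 1), (1, 2)} \<union> {(0, i) | i. 3 \<le> i \<and> i \<le> d + 2})"

lemma star_graph_complete_bipartite: "K\<^bsub>1,m\<^esub> (with_proj (star_graph m))"
  unfolding complete_bipartite_digraph_pair_def
proof (intro conjI exI)
  show "pverts (star_graph m) = {0} \<union> {1..m}"
    by (auto simp: star_graph_def sym_graph_def)
  show "parcs (star_graph m) = {0} \<times> {1..m} \<union> {1..m} \<times> {0}"
    by (auto simp: star_graph_def sym_graph_def)
qed (simp_all add: star_graph_def sym_graph_def)

lemma card_pverts_star_graph: "card (pverts (star_graph m)) = m + 1"
  by (simp add: star_graph_def sym_graph_def)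

lemma card_pverts_spider_graph: "card (pverts (spider_graph d)) = d + 3"
  by (simp add: spider_graph_def sym_graph_def)

end

theory Submission
  imports Defs
begin

text \<open>
  In a bipartite graph, a spider with d one-edge legs is present iff some vertex of degree more than d
  has a neighbour of degree at least 2 (bipartiteness keeps the end of the long leg off the
  neighbourhood of the centre). Hence, in a spider-free graph, each vertex of degree more than d is
  the centre of a star component. For \<open>d \<ge> 2\<close> such components have average degree less than 2, so the
  average degree is at most d; the d-regular circulant is extremal, and is connected as it contains a
  Hamiltonian cycle. For \<open>d = 1\<close> all components are stars, of which at least two are needed to
  cover two parts of size \<open>n \<ge> 2\<close>.
\<close>

section \<open>Copies and isomorphisms in terms of vertex maps\<close>

text \<open>An arc of a pair digraph is its pair of endpoints, so the arc component of a library
  isomorphism is forced by the vertex map.\<close>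

lemma digraph_iso_pair_iff:
  assumes "pair_wf_digraph F"
  shows "digraph_iso (with_proj F) (with_proj H) \<longleftrightarrow>
    (\<exists>f. inj_on f (pverts F) \<and> pverts H = f ` pverts F \<and> parcs H = map_prod f f ` parcs F)"
proof -
  interpret F: pair_wf_digraph F by (rule assms)
  have wf: "wf_digraph (with_proj F)" by unfold_locales
  show ?thesis
  proof
    assume "digraph_iso (with_proj F) (with_proj H)"
    then obtain h where h: "F.digraph_isomorphism h" "with_proj H = app_iso h (with_proj F)"
      unfolding digraph_iso_def by blast
    have t: "iso_tail h = fst" "iso_head h = snd" and v: "pverts H = iso_verts h ` pverts F"
      and a: "parcs H = iso_arcs h ` parcs F"
      using h(2) by (simp_all add: with_proj_def app_iso_def)
    have "iso_arcs h e = map_prod (iso_verts h) (iso_verts h) e" if "e \<in> parcs F" for e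
      using h(1) that t unfolding F.digraph_isomorphism_def
      by (cases e, cases "iso_arcs h e") force
    then have "parcs H = map_prod (iso_verts h) (iso_verts h) ` parcs F"
      unfolding a by (intro image_cong) auto
    then show "\<exists>f. inj_on f (pverts F) \<and> pverts H = f ` pverts F \<and> parcs H = map_prod f f ` parcs F"
      using h(1) v unfolding F.digraph_isomorphism_def by blast
  next
    assume "\<exists>f. inj_on f (pverts F) \<and> pverts H = f ` pverts F \<and> parcs H = map_prod f f ` parcs F"
    then obtain f where f: "inj_on f (pverts F)" "pverts H = f ` pverts F"
      "parcs H = map_prod f f ` parcs F" by blast
    define h where "h = \<lparr>iso_verts = f, iso_arcs = map_prod f f, iso_head = snd, iso_tail = fst\<rparr>"
    have "inj_on (map_prod f f) (pverts F \<times> pverts F)"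
      using f(1) by (intro map_prod_inj_on)
    then have "inj_on (map_prod f f) (parcs F)"
      by (rule inj_on_subset) (auto dest: F.in_arcsD1 F.in_arcsD2)
    then have "F.digraph_isomorphism h"
      using f(1) wf unfolding F.digraph_isomorphism_def h_def by auto
    moreover have "with_proj H = app_iso h (with_proj F)"
      by (simp add: with_proj_def app_iso_def h_def f)
    ultimately show "digraph_iso (with_proj F) (with_proj H)"
      unfolding digraph_iso_def by blast
  qed
qed

text \<open>The image of \<open>F\<close> under an injective vertex map serves as the subgraph
  \<open>H\<close>; copies are handled as such maps from here on.\<close>

lemma contains_copy_iff:
  assumes "pair_wf_digraph F" "pair_wf_digraph G"
  shows "contains_copy F G \<longleftrightarrow>
    (\<exists>f. inj_on f (pverts F) \<and> f ` pverts F \<subseteq> pverts G \<and> map_prod f f ` parcs F \<subseteq> parcs G)"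
    (is "_ \<longleftrightarrow> (\<exists>f. ?P f)")
proof
  assume "contains_copy F G"
  then show "\<exists>f. ?P f"
    unfolding contains_copy_def subgraph_def digraph_iso_pair_iff[OF assms(1)] by fastforce
next
  assume "\<exists>f. ?P f"
  then obtain f where f: "?P f" by blast
  define H where "H = \<lparr>pverts = f ` pverts F, parcs = map_prod f f ` parcs F\<rparr>"
  interpret F: pair_wf_digraph F by (rule assms)
  have "pair_wf_digraph H"
    by unfold_locales (auto simp: H_def dest: F.in_arcsD1 F.in_arcsD2)
  then have "subgraph (with_proj H) (with_proj G)"
    using f assms(2) by (auto simp: subgraph_def wf_digraph_wp_iff H_def)
  moreover have "digraph_iso (with_proj F) (with_proj H)"
    unfolding digraph_iso_pair_iff[OF assms(1)] using f by (auto simp: H_def)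
  ultimately show "contains_copy F G" unfolding contains_copy_def by blast
qed

text \<open>Copies are transported by composing with the isomorphism or its inverse. This carries
  results on stars and spiders over to \<open>path_graph 3\<close> and
  \<open>path_graph 4\<close>.\<close>

lemma contains_copy_iso:
  assumes "digraph_iso (with_proj F) (with_proj F')"
    "pair_wf_digraph F" "pair_wf_digraph F'" "pair_wf_digraph G"
  shows "contains_copy F G \<longleftrightarrow> contains_copy F' G"
proof -
  obtain f where f: "inj_on f (pverts F)" "pverts F' = f ` pverts F"
    "parcs F' = map_prod f f ` parcs F"
    using assms(1) unfolding digraph_iso_pair_iff[OF assms(2)] by auto
  interpret F: pair_wf_digraph F by (rule assms)
  show ?thesis unfolding contains_copy_iff[OF assms(2,4)] contains_copy_iff[OF assms(3,4)]
  proof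
    assume "\<exists>g. inj_on g (pverts F) \<and> g ` pverts F \<subseteq> pverts G \<and> map_prod g g ` parcs F \<subseteq> parcs G"
    then obtain g where g: "inj_on g (pverts F)" "g ` pverts F \<subseteq> pverts G"
      "map_prod g g ` parcs F \<subseteq> parcs G" by blast
    \<comment> \<open>The inverse of the isomorphism \<open>f\<close>, followed by
      \<open>g\<close>.\<close>
    define k where "k = g \<circ> the_inv_into (pverts F) f"
    have k: "k (f v) = g v" if "v \<in> pverts F" for v
      using f(1) that by (simp add: k_def the_inv_into_f_f)
    show "\<exists>g. inj_on g (pverts F') \<and> g ` pverts F' \<subseteq> pverts G \<and> map_prod g g ` parcs F' \<subseteq> parcs G"
    proof (intro exI conjI)
      show "inj_on k (pverts F')"
        unfolding f(2) using g(1) k by (auto simp: inj_on_def)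
      show "k ` pverts F' \<subseteq> pverts G"
        unfolding f(2) using g(2) k by auto
      show "map_prod k k ` parcs F' \<subseteq> parcs G"
      proof
        fix e assume "e \<in> map_prod k k ` parcs F'"
        then obtain u v where uv: "(u, v) \<in> parcs F" "e = (k (f u), k (f v))"
          unfolding f(3) by auto
        then have "e = map_prod g g (u, v)"
          using k F.in_arcsD1 F.in_arcsD2 by simp
        then show "e \<in> parcs G" using uv(1) g(3) by blast
      qed
    qed
  next
    assume "\<exists>g. inj_on g (pverts F') \<and> g ` pverts F' \<subseteq> pverts G \<and> map_prod g g ` parcs F' \<subseteq> parcs G"
    then obtain g where g: "inj_on g (pverts F')" "g ` pverts F' \<subseteq> pverts G"
      "map_prod g g ` parcs F' \<subseteq> parcs G" by blast
    show "\<exists>g. inj_on g (pverts F) \<and> g ` pverts F \<subseteq> pverts G \<and> map_prod g g ` parcs F \<subseteq> parcs G"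
    proof (intro exI conjI)
      show "inj_on (g \<circ> f) (pverts F)" using f g by (simp add: comp_inj_on)
      show "(g \<circ> f) ` pverts F \<subseteq> pverts G" using f g by auto
      show "map_prod (g \<circ> f) (g \<circ> f) ` parcs F \<subseteq> parcs G" using f g by (auto simp: image_comp)
    qed
  qed
qed

section \<open>The forbidden graphs, and their coincidence with paths for d = 1\<close>

lemma pair_wf_digraph_sym_graph:
  "A \<subseteq> V \<times> V \<Longrightarrow> pair_wf_digraph (sym_graph V A)"
  by unfold_locales (auto simp: sym_graph_def)

lemma pair_wf_digraph_path_graph: "pair_wf_digraph (path_graph k)"
  unfolding path_graph_def by (rule pair_wf_digraph_sym_graph) auto

lemma pair_wf_digraph_star_graph: "pair_wf_digraph (star_graph m)"
  unfolding star_graph_def by (rule pair_wf_digraph_sym_graph) auto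

lemma pair_wf_digraph_spider_graph: "pair_wf_digraph (spider_graph d)"
  unfolding spider_graph_def by (rule pair_wf_digraph_sym_graph) auto

lemma pverts_star_graph: "pverts (star_graph m) = {..m}"
  by (simp add: star_graph_def sym_graph_def)

lemma pverts_spider_graph: "pverts (spider_graph d) = {..d + 2}"
  by (simp add: spider_graph_def sym_graph_def)

lemma star_graph_2_iso_path_graph_3:
  "digraph_iso (with_proj (star_graph 2)) (with_proj (path_graph 3))"
  unfolding digraph_iso_pair_iff[OF pair_wf_digraph_star_graph]
proof (intro exI conjI)
  \<comment> \<open>The centre 0 of the star becomes the middle vertex 1 of the path.\<close>
  let ?f = "\<lambda>i::nat. if i = 0 then 1 else if i = 1 then 0 else i"
  have star: "pverts (star_graph 2) = {0, 1, 2}" "parcs (star_graph 2) = {(0,1), (0,2), (1,0), (2,0)}"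
    by (auto simp: star_graph_def sym_graph_def)
  have path: "pverts (path_graph 3) = {0, 1, 2}" "parcs (path_graph 3) = {(0,1), (1,2), (1,0), (2,1)}"
    by (auto simp: path_graph_def sym_graph_def)
  show "inj_on ?f (pverts (star_graph 2))" "pverts (path_graph 3) = ?f ` pverts (star_graph 2)"
    "parcs (path_graph 3) = map_prod ?f ?f ` parcs (star_graph 2)"
    unfolding star path by auto
qed

lemma spider_graph_1_iso_path_graph_4:
  "digraph_iso (with_proj (spider_graph 1)) (with_proj (path_graph 4))"
  unfolding digraph_iso_pair_iff[OF pair_wf_digraph_spider_graph]
proof (intro exI conjI)
  \<comment> \<open>Read along its length, the spider is the path 3 - 0 - 1 - 2.\<close>
  let ?f = "\<lambda>i::nat. if i = 3 then 0 else Suc i"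
  have spider: "pverts (spider_graph 1) = {0, 1, 2, 3}"
    "parcs (spider_graph 1) = {(0,1), (1,2), (0,3), (1,0), (2,1), (3,0)}"
    by (auto simp: spider_graph_def sym_graph_def)
  have path: "pverts (path_graph 4) = {0, 1, 2, 3}"
    "parcs (path_graph 4) = {(0,1), (1,2), (2,3), (1,0), (2,1), (3,2)}"
    by (auto simp: path_graph_def sym_graph_def)
  show "inj_on ?f (pverts (spider_graph 1))" "pverts (path_graph 4) = ?f ` pverts (spider_graph 1)"
    "parcs (path_graph 4) = map_prod ?f ?f ` parcs (spider_graph 1)"
    unfolding spider path by auto
qed

section \<open>Neighbourhoods in bipartite graphs\<close>

definition nbrs :: "'a pair_pre_digraph \<Rightarrow> 'a \<Rightarrow> 'a set" where
  "nbrs G v = {w. (v, w) \<in> parcs G}"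

lemma (in pair_fin_digraph) finite_nbrs: "finite (nbrs G v)"
  by (rule finite_subset[OF _ pair_finite_verts]) (auto simp: nbrs_def dest: in_arcsD2)

text \<open>A centre and \<open>m\<close> of its neighbours already form a star. As \<open>v\<close>
  ranges over the whole type, the right side for \<open>m = 0\<close> would hold even in the graph
  without vertices, hence \<open>m \<ge> 1\<close>.\<close>

lemma (in pair_graph) contains_star_iff:
  assumes "m \<ge> 1"
  shows "contains_copy (star_graph m) G \<longleftrightarrow> (\<exists>v. m \<le> card (nbrs G v))"
  unfolding contains_copy_iff[OF pair_wf_digraph_star_graph pair_wf_digraph]
proof
  assume "\<exists>f. inj_on f (pverts (star_graph m)) \<and> f ` pverts (star_graph m) \<subseteq> pverts G \<and>
    map_prod f f ` parcs (star_graph m) \<subseteq> parcs G"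
  then obtain f where f: "inj_on f {..m}" "map_prod f f ` parcs (star_graph m) \<subseteq> parcs G"
    unfolding pverts_star_graph by blast
  have "f i \<in> nbrs G (f 0)" if "i \<in> {1..m}" for i
    using subsetD[OF f(2), OF imageI, of "(0, i)"] that
    by (simp add: nbrs_def star_graph_def sym_graph_def)
  then have "f ` {1..m} \<subseteq> nbrs G (f 0)" by auto
  moreover have "card (f ` {1..m}) = m"
    by (subst card_image) (auto intro: inj_on_subset[OF f(1)])
  ultimately have "m \<le> card (nbrs G (f 0))"
    using card_mono[OF finite_nbrs] by metis
  then show "\<exists>v. m \<le> card (nbrs G v)" ..
next
  assume "\<exists>v. m \<le> card (nbrs G v)"
  then obtain v D where D: "D \<subseteq> nbrs G v" "card D = m" "finite D"
    by (meson obtain_subset_with_card_n)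
  obtain h where h: "bij_betw h {1..m} D"
    using D finite_same_card_bij[of "{1..m}" D] by auto
  define f where "f = (\<lambda>i. if i = 0 then v else h i)"
  have hD: "h i \<in> D" if "1 \<le> i" "i \<le> m" for i
    using bij_betwE[OF h] that by simp
  have arc: "(v, h i) \<in> parcs G" if "1 \<le> i" "i \<le> m" for i
    using hD[OF that] D by (auto simp: nbrs_def)
  have "f ` {1..m} = h ` {1..m}" by (rule image_cong) (simp_all add: f_def)
  then have "f ` {1..m} = D" using bij_betw_imp_surj_on[OF h] by simp
  moreover have "v \<notin> D" using D(1) no_loops' by (auto simp: nbrs_def)
  moreover have "inj_on f {1..m} \<longleftrightarrow> inj_on h {1..m}"
    by (rule inj_on_cong) (simp add: f_def)
  moreover have "{..m} = insert 0 {1..m}" by auto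
  moreover have "f 0 = v" by (simp add: f_def)
  ultimately have "inj_on f {..m}"
    using bij_betw_imp_inj_on[OF h] by simp
  \<comment> \<open>By \<open>m \<ge> 1\<close>, \<open>v\<close> is the tail of some arc and hence
    a vertex.\<close>
  moreover have "v \<in> pverts G" using in_arcsD1[OF arc[of 1]] assms by simp
  then have "f ` {..m} \<subseteq> pverts G"
    using in_arcsD2[OF arc] by (auto simp: f_def)
  moreover have "map_prod f f ` parcs (star_graph m) \<subseteq> parcs G"
    using arc arcs_symmetric[OF arc] by (auto simp: f_def star_graph_def sym_graph_def)
  ultimately show "\<exists>f. inj_on f (pverts (star_graph m)) \<and> f ` pverts (star_graph m) \<subseteq> pverts G \<and>
    map_prod f f ` parcs (star_graph m) \<subseteq> parcs G"
    unfolding pverts_star_graph by blast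
qed

text \<open>Connectedness in the library is strong connectedness of the symmetric closure; here the
  arcs are symmetric already.\<close>

lemma (in pair_graph) conn_iff:
  "conn G \<longleftrightarrow> pverts G \<noteq> {} \<and> (\<forall>u\<in>pverts G. \<forall>v\<in>pverts G. (u, v) \<in> (parcs G)\<^sup>*)"
proof -
  show ?thesis
    unfolding conn_def Digraph_Component.connected_def strongly_connected_def
    using reachable_mk_symmetric_eq[OF pair_sym_arcs] reachable_conv' by auto
qed

section \<open>Fixed bipartitions: edge counts by degrees, spiders, and upper bounds\<close>

locale bipartite_graph = pair_graph G for G :: "'a pair_pre_digraph" +
  fixes X Y :: "'a set"
  assumes verts_eq: "pverts G = X \<union> Y" and disjoint: "X \<inter> Y = {}"
    and arcs_subset: "parcs G \<subseteq> X \<times> Y \<union> Y \<times> X"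
begin

lemma swap: "bipartite_graph G Y X"
  by unfold_locales (use verts_eq disjoint arcs_subset in auto)

lemma finite_parts: "finite X" "finite Y"
  using pair_finite_verts verts_eq by auto

lemma nbrs_X: "v \<in> X \<Longrightarrow> nbrs G v \<subseteq> Y" and nbrs_Y: "v \<in> Y \<Longrightarrow> nbrs G v \<subseteq> X"
  using arcs_subset disjoint by (auto simp: nbrs_def)

text \<open>Each edge has exactly one endpoint in \<open>X\<close>, so edges correspond to pairs of
  a vertex of \<open>X\<close> and one of its neighbours.\<close>

lemma card_edges_eq_sum: "card (edges G) = (\<Sum>x\<in>X. card (nbrs G x))"
proof -
  have "edges G = (\<lambda>(u, v). {u, v}) ` Sigma X (nbrs G)"
  proof
    show "edges G \<subseteq> (\<lambda>(u, v). {u, v}) ` Sigma X (nbrs G)"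
    proof
      fix e assume "e \<in> edges G"
      then obtain u v where uv: "(u, v) \<in> parcs G" "e = {u, v}" by (auto simp: edges_def)
      then consider "u \<in> X" | "v \<in> X" using arcs_subset by auto
      then show "e \<in> (\<lambda>(u, v). {u, v}) ` Sigma X (nbrs G)"
      proof cases
        case 1
        then show ?thesis using uv by (auto simp: nbrs_def image_iff)
      next
        case 2
        then have "(v, u) \<in> Sigma X (nbrs G)"
          using uv arcs_symmetric by (auto simp: nbrs_def)
        then show ?thesis using uv(2) by (force simp: insert_commute)
      qed
    qed
  qed (auto simp: edges_def nbrs_def)
  moreover have "inj_on (\<lambda>(u, v). {u, v}) (Sigma X (nbrs G))"
    using nbrs_X disjoint by (auto simp: inj_on_def doubleton_eq_iff)
  ultimately have "card (edges G) = card (Sigma X (nbrs G))"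
    by (simp add: card_image)
  then show ?thesis using finite_parts finite_nbrs by simp
qed

lemma sum_degrees: "(\<Sum>v\<in>pverts G. card (nbrs G v)) = 2 * card (edges G)"
proof -
  interpret S: bipartite_graph G Y X by (rule swap)
  show ?thesis unfolding verts_eq
    using card_edges_eq_sum S.card_edges_eq_sum finite_parts disjoint
    by (simp add: sum.union_disjoint)
qed

lemma card_edges_le_of_degree_le:
  assumes "\<And>v. card (nbrs G v) \<le> d"
  shows "card (edges G) \<le> d * card X"
  unfolding card_edges_eq_sum using sum_bounded_above[of X "\<lambda>x. card (nbrs G x)" d] assms
  by (simp add: mult.commute)

text \<open>With \<open>w\<close> and \<open>x\<close> as the long leg, at least \<open>d\<close>
  other neighbours of \<open>v\<close> remain for the short legs. The walk with
  \<open>x \<noteq> v\<close> says that \<open>w\<close> has a second neighbour.\<close>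

lemma contains_spider_iff:
  "contains_copy (spider_graph d) G \<longleftrightarrow>
    (\<exists>v w x. (v, w) \<in> parcs G \<and> (w, x) \<in> parcs G \<and> x \<noteq> v \<and> d < card (nbrs G v))"
  (is "_ \<longleftrightarrow> ?R")
  unfolding contains_copy_iff[OF pair_wf_digraph_spider_graph pair_wf_digraph]
proof
  assume "\<exists>f. inj_on f (pverts (spider_graph d)) \<and> f ` pverts (spider_graph d) \<subseteq> pverts G \<and>
    map_prod f f ` parcs (spider_graph d) \<subseteq> parcs G"
  then obtain f where f: "inj_on f {..d + 2}" "map_prod f f ` parcs (spider_graph d) \<subseteq> parcs G"
    unfolding pverts_spider_graph by blast
  \<comment> \<open>The labels of the \<open>d + 1\<close> neighbours of the centre; 2 is the end of
    the long leg.\<close>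
  let ?L = "insert 1 {3..d + 2}"
  have "f i \<in> nbrs G (f 0)" if "i \<in> ?L" for i
    using subsetD[OF f(2), OF imageI, of "(0, i)"] that
    by (auto simp: nbrs_def spider_graph_def sym_graph_def)
  then have "f ` ?L \<subseteq> nbrs G (f 0)" by auto
  moreover have "inj_on f ?L" by (rule inj_on_subset[OF f(1)]) auto
  then have "card (f ` ?L) = Suc d" by (simp add: card_image)
  ultimately have "d < card (nbrs G (f 0))"
    using card_mono[OF finite_nbrs] by (metis Suc_le_eq)
  moreover have "(f 0, f 1) \<in> parcs G" "(f 1, f 2) \<in> parcs G"
    using f(2) by (auto simp: spider_graph_def sym_graph_def)
  moreover have "f 2 \<noteq> f 0"
    using inj_onD[OF f(1), of 2 0] by auto
  ultimately show ?R by blast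
next
  assume ?R
  then obtain v w x where vwx: "(v, w) \<in> parcs G" "(w, x) \<in> parcs G" "x \<noteq> v"
    and deg: "d < card (nbrs G v)" by blast
  have "d \<le> card (nbrs G v - {w})" using deg by (auto simp: card_Diff_singleton_if)
  then obtain D where D: "D \<subseteq> nbrs G v - {w}" "card D = d" "finite D"
    by (meson obtain_subset_with_card_n)
  obtain h where h: "bij_betw h {3..d + 2} D"
    using D finite_same_card_bij[of "{3..d + 2}" D] by auto
  define f where "f = (\<lambda>i::nat. if i = 0 then v else if i = 1 then w else if i = 2 then x else h i)"
  have hD: "h i \<in> D" if "3 \<le> i" "i \<le> d + 2" for i
    using bij_betwE[OF h] that by simp
  have arc: "(v, h i) \<in> parcs G" if "3 \<le> i" "i \<le> d + 2" for i
    using hD[OF that] D by (auto simp: nbrs_def)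
  \<comment> \<open>Both \<open>v\<close> and \<open>x\<close> lie in the part opposite to
    \<open>w\<close>, which keeps \<open>x\<close> off the short legs.\<close>
  have "(v, x) \<notin> parcs G"
    using vwx(1,2) arcs_subset disjoint by auto
  then have "v \<notin> D" "w \<notin> D" "x \<notin> D"
    using D(1) no_loops' by (auto simp: nbrs_def)
  moreover have "f ` {3..d + 2} = h ` {3..d + 2}" by (rule image_cong) (simp_all add: f_def)
  then have "f ` {3..d + 2} = D" using bij_betw_imp_surj_on[OF h] by simp
  moreover have "v \<noteq> w" "w \<noteq> x" using vwx no_loops' by auto
  moreover have "inj_on f {3..d + 2} \<longleftrightarrow> inj_on h {3..d + 2}"
    by (rule inj_on_cong) (simp add: f_def)
  moreover have "f 0 = v" "f 1 = w" "f 2 = x" by (simp_all add: f_def)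
  moreover have "{..d + 2} = insert 0 (insert 1 (insert 2 {3..d + 2}))" by auto
  ultimately have "inj_on f {..d + 2}"
    using vwx(3) bij_betw_imp_inj_on[OF h] by simp
  moreover have "f ` {..d + 2} \<subseteq> pverts G"
    using in_arcsD2[OF arc] in_arcsD1[OF vwx(1)] in_arcsD1[OF vwx(2)] in_arcsD2[OF vwx(2)]
    by (auto simp: f_def)
  moreover have "map_prod f f ` parcs (spider_graph d) \<subseteq> parcs G"
    using arc arcs_symmetric[OF arc] vwx(1,2) vwx(1,2)[THEN arcs_symmetric]
    by (auto simp: f_def spider_graph_def sym_graph_def)
  ultimately show "\<exists>f. inj_on f (pverts (spider_graph d)) \<and> f ` pverts (spider_graph d) \<subseteq> pverts G \<and>
    map_prod f f ` parcs (spider_graph d) \<subseteq> parcs G"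
    unfolding pverts_spider_graph by blast
qed

text \<open>Let \<open>B\<close> be the set of vertices of degree above \<open>d\<close> and
  \<open>L\<close> that of their neighbours, all leaves. Together they contribute
  \<open>2 * card L \<le> d * card L\<close> to the degree sum, and every other vertex at most
  \<open>d\<close>; so the sum is at most \<open>d * (2 * n)\<close>.\<close>

lemma card_edges_le_of_spider_free:
  assumes "d \<ge> 2" "card X = n" "card Y = n" "\<not> contains_copy (spider_graph d) G"
  shows "card (edges G) \<le> d * n"
proof -
  define B where "B = {v \<in> pverts G. d < card (nbrs G v)}"
  define L where "L = (\<Union>v\<in>B. nbrs G v)"
  \<comment> \<open>A second neighbour of \<open>w\<close> would end the long leg of a spider
    centred at \<open>v\<close>.\<close>
  have leaf: "nbrs G w = {v}" if "v \<in> B" "w \<in> nbrs G v" for v w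
    using that assms(4) arcs_symmetric unfolding contains_spider_iff B_def nbrs_def by blast
  have fin: "finite B" "finite L"
    using pair_finite_verts finite_nbrs by (auto simp: B_def L_def)
  have sub: "B \<subseteq> pverts G" "L \<subseteq> pverts G"
    by (auto simp: B_def L_def nbrs_def dest: in_arcsD2)
  have L1: "card (nbrs G w) = 1" if "w \<in> L" for w
    using that leaf by (auto simp: L_def)
  have BL: "B \<inter> L = {}"
    using L1 assms(1) by (fastforce simp: B_def)
  \<comment> \<open>A leaf has only one neighbour, so distinct centres have disjoint
    neighbourhoods.\<close>
  have cardL: "card L = (\<Sum>v\<in>B. card (nbrs G v))"
    unfolding L_def
  proof (rule card_UN_disjoint)
    show "\<forall>v\<in>B. \<forall>v'\<in>B. v \<noteq> v' \<longrightarrow> nbrs G v \<inter> nbrs G v' = {}"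
      using leaf by blast
  qed (use fin finite_nbrs in auto)
  let ?R = "pverts G - (B \<union> L)"
  have eq: "pverts G = (B \<union> L) \<union> ?R" using sub by auto
  have "2 * card (edges G) = (\<Sum>v\<in>(B \<union> L) \<union> ?R. card (nbrs G v))"
    using sum_degrees eq by simp
  also have "\<dots> = (\<Sum>v\<in>B. card (nbrs G v)) + (\<Sum>v\<in>L. card (nbrs G v)) + (\<Sum>v\<in>?R. card (nbrs G v))"
    using fin BL pair_finite_verts
    by (subst sum.union_disjoint) (auto simp: sum.union_disjoint)
  also have "(\<Sum>v\<in>L. card (nbrs G v)) = card L" using L1 by simp
  also have "(\<Sum>v\<in>?R. card (nbrs G v)) \<le> card ?R * d"
    using sum_bounded_above[of ?R "\<lambda>v. card (nbrs G v)" d] by (simp add: B_def not_less)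
  also have "(\<Sum>v\<in>B. card (nbrs G v)) + card L + card ?R * d \<le> (card L + card ?R) * d"
    using mult_le_mono2[OF assms(1), of "card L"] unfolding cardL[symmetric] add_mult_distrib
    by linarith
  also have "card L + card ?R = card (L \<union> ?R)"
    using fin pair_finite_verts by (subst card_Un_disjoint) auto
  also have "card (L \<union> ?R) \<le> card (pverts G)"
    using sub pair_finite_verts by (intro card_mono) auto
  also have "card (pverts G) = 2 * n"
    using finite_parts disjoint assms by (simp add: verts_eq card_Un_disjoint)
  finally show ?thesis by (simp add: mult.commute)
qed

text \<open>Every edge can be charged to an endpoint of degree at most 1. If both parts have a
  vertex of larger degree, at most \<open>2 * (n - 1)\<close> vertices are charged; otherwise the
  degrees in one part sum to at most \<open>n\<close>.\<close>

lemma card_edges_le_of_spider_1_free: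
  assumes "card X = n" "card Y = n" "n \<ge> 2" "\<not> contains_copy (spider_graph 1) G"
  shows "card (edges G) \<le> 2 * n - 2"
proof -
  interpret S: bipartite_graph G Y X by (rule swap)
  have le: "n \<le> 2 * n - 2" using assms(3) by simp
  consider "\<forall>x\<in>X. card (nbrs G x) \<le> 1" | "\<forall>y\<in>Y. card (nbrs G y) \<le> 1"
    | x0 y0 where "x0 \<in> X" "y0 \<in> Y" "card (nbrs G x0) > 1" "card (nbrs G y0) > 1"
    by (meson not_le)
  then show ?thesis
  proof cases
    case 1
    then have "card (edges G) \<le> n"
      unfolding card_edges_eq_sum using sum_bounded_above[of X "\<lambda>x. card (nbrs G x)" 1] assms(1) by simp
    then show ?thesis using le by simp
  next
    case 2
    then have "card (edges G) \<le> n"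
      unfolding S.card_edges_eq_sum using sum_bounded_above[of Y "\<lambda>x. card (nbrs G x)" 1] assms(2) by simp
    then show ?thesis using le by simp
  next
    case 3
    let ?LX = "{x \<in> X. card (nbrs G x) \<le> 1}" and ?LY = "{y \<in> Y. card (nbrs G y) \<le> 1}"
    have fin: "finite ?LX" "finite ?LY" using finite_parts by auto
    \<comment> \<open>If both degrees exceed 1, a second neighbour of \<open>y\<close> ends the long
      leg of a spider centred at \<open>x\<close>.\<close>
    have leaf: "card (nbrs G x) \<le> 1 \<or> card (nbrs G y) \<le> 1" if "(x, y) \<in> parcs G" for x y
    proof (rule ccontr)
      assume deg: "\<not> ?thesis"
      moreover have "x \<in> nbrs G y" using arcs_symmetric[OF that] by (simp add: nbrs_def)
      ultimately obtain x' where "(y, x') \<in> parcs G" "x' \<noteq> x"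
        by (metis One_nat_def card_le_Suc0_iff_eq finite_nbrs mem_Collect_eq nbrs_def)
      then show False
        using assms(4) deg that unfolding contains_spider_iff by (meson not_le)
    qed
    \<comment> \<open>The charging: pairs start in \<open>X\<close>, so those charged to a vertex of
      \<open>Y\<close> arise by swapping.\<close>
    have "Sigma X (nbrs G) \<subseteq> Sigma ?LX (nbrs G) \<union> prod.swap ` Sigma ?LY (nbrs G)"
      using leaf nbrs_X arcs_symmetric by (force simp: nbrs_def)
    then have "card (Sigma X (nbrs G)) \<le> card (Sigma ?LX (nbrs G) \<union> prod.swap ` Sigma ?LY (nbrs G))"
      using fin finite_nbrs by (intro card_mono) auto
    also have "\<dots> \<le> card (Sigma ?LX (nbrs G)) + card (prod.swap ` Sigma ?LY (nbrs G))"
      by (rule card_Un_le)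
    also have "card (prod.swap ` Sigma ?LY (nbrs G)) = card (Sigma ?LY (nbrs G))"
      by (rule card_image) (simp add: inj_on_def)
    finally have "card (edges G) \<le> (\<Sum>x\<in>?LX. card (nbrs G x)) + (\<Sum>y\<in>?LY. card (nbrs G y))"
      using fin finite_parts finite_nbrs by (simp add: card_edges_eq_sum)
    also have "\<dots> \<le> card ?LX + card ?LY"
      using sum_bounded_above[of ?LX "\<lambda>x. card (nbrs G x)" 1]
        sum_bounded_above[of ?LY "\<lambda>x. card (nbrs G x)" 1] by simp
    also have "?LX \<subseteq> X - {x0}" "?LY \<subseteq> Y - {y0}" using 3 by auto
    then have "card ?LX \<le> card (X - {x0})" "card ?LY \<le> card (Y - {y0})"
      using finite_parts by (simp_all only: card_mono finite_Diff)
    then have "card ?LX + card ?LY \<le> 2 * n - 2"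
      using 3 assms finite_parts by simp
    finally show ?thesis .
  qed
qed

text \<open>Without a spider there is a vertex \<open>c\<close> to which every walk of two steps
  from \<open>c\<close> returns. By connectedness \<open>c\<close> and its neighbours are all the
  vertices, so the part of \<open>c\<close> is a singleton, against
  \<open>n \<ge> 2\<close>.\<close>

lemma conn_contains_spider_1:
  assumes "card X = n" "card Y = n" "n \<ge> 2" "conn G"
  shows "contains_copy (spider_graph 1) G"
proof (rule ccontr)
  assume free: "\<not> contains_copy (spider_graph 1) G"
  obtain x y where "x \<in> X" "y \<in> Y" using assms by fastforce
  then have "(x, y) \<in> (parcs G)\<^sup>*" "x \<noteq> y"
    using assms(4) disjoint by (auto simp: conn_iff verts_eq)
  then obtain u w where uw: "(u, w) \<in> parcs G"
    by (meson converse_rtranclE)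
  \<comment> \<open>If some walk of two steps from \<open>u\<close> ends elsewhere, its middle
    vertex has degree at least 2, and spider-freeness makes that vertex a valid
    \<open>c\<close>.\<close>
  obtain c where c: "\<And>w x. (c, w) \<in> parcs G \<Longrightarrow> (w, x) \<in> parcs G \<Longrightarrow> x = c"
    and c_in: "c \<in> pverts G"
  proof (cases "\<forall>w x. (u, w) \<in> parcs G \<and> (w, x) \<in> parcs G \<longrightarrow> x = u")
    case True
    then show ?thesis using that[of u] in_arcsD1[OF uw] by blast
  next
    case False
    then obtain w' x' where w': "(u, w') \<in> parcs G" "(w', x') \<in> parcs G" "x' \<noteq> u" by blast
    have "{u, x'} \<subseteq> nbrs G w'"
      using w' arcs_symmetric by (auto simp: nbrs_def)
    then have "card {u, x'} \<le> card (nbrs G w')" by (intro card_mono finite_nbrs)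
    then have "1 < card (nbrs G w')" using w'(3) by simp
    then show ?thesis
      using that[of w'] free in_arcsD2[OF w'(1)] unfolding contains_spider_iff by blast
  qed
  have reach: "v \<in> insert c (nbrs G c)" if "(c, v) \<in> (parcs G)\<^sup>*" for v
    using that by induction (use c in \<open>auto simp: nbrs_def\<close>)
  then have all: "pverts G \<subseteq> insert c (nbrs G c)"
    using assms(4) c_in by (auto simp: conn_iff)
  \<comment> \<open>The neighbours of \<open>c\<close> all lie in the opposite part.\<close>
  have "X \<subseteq> {c} \<or> Y \<subseteq> {c}"
    using c_in all nbrs_X nbrs_Y disjoint unfolding verts_eq by blast
  then show False
    using card_mono[of "{c}" X] card_mono[of "{c}" Y] assms by auto
qed

end

lemma balanced_bipartite_iff:
  "balanced_bipartite n G \<longleftrightarrow> (\<exists>X Y. bipartite_graph G X Y \<and> card X = n \<and> card Y = n)"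
  unfolding balanced_bipartite_def bipartite_graph_def bipartite_graph_axioms_def by blast

section \<open>Extremal graphs\<close>

definition bip_graph :: "nat \<Rightarrow> (nat \<Rightarrow> nat \<Rightarrow> bool) \<Rightarrow> nat pair_pre_digraph" where
  "bip_graph n R = sym_graph {..<2 * n} {(i, n + j) | i j. i < n \<and> j < n \<and> R i j}"

lemma arc_bip_graph:
  "i < n \<Longrightarrow> j < n \<Longrightarrow> R i j \<Longrightarrow> (i, n + j) \<in> parcs (bip_graph n R)"
  by (auto simp: bip_graph_def sym_graph_def)

lemma bipartite_graph_bip_graph: "bipartite_graph (bip_graph n R) {..<n} {n..<2 * n}"
proof unfold_locales
  have "parcs (bip_graph n R) \<subseteq> {..<2 * n} \<times> {..<2 * n}"
    by (auto simp: bip_graph_def sym_graph_def)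
  then show "finite (parcs (bip_graph n R))" by (rule finite_subset) simp
qed (auto simp: bip_graph_def sym_graph_def symmetric_def intro!: symI)

lemma balanced_bipartite_bip_graph: "balanced_bipartite n (bip_graph n R)"
  unfolding balanced_bipartite_iff
  by (intro exI[of _ "{..<n}"] exI[of _ "{n..<2 * n}"]) (simp add: bipartite_graph_bip_graph)

lemma nbrs_bip_graph_left: "i < n \<Longrightarrow> nbrs (bip_graph n R) i = (+) n ` {j. j < n \<and> R i j}"
  by (auto simp: nbrs_def bip_graph_def sym_graph_def)

lemma nbrs_bip_graph_right: "j < n \<Longrightarrow> nbrs (bip_graph n R) (n + j) = {i. i < n \<and> R i j}"
  by (auto simp: nbrs_def bip_graph_def sym_graph_def)

text \<open>Degree bounds range over all natural numbers, so those outside the graph form a case of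
  their own.\<close>

lemma bip_graph_vertex_cases:
  obtains (left) "v < n" | (right) j where "j < n" "v = n + j"
    | (none) "nbrs (bip_graph n R) v = {}"
proof -
  consider "v < n" | "n \<le> v" "v < 2 * n" | "v \<ge> 2 * n" by linarith
  then show ?thesis
  proof cases
    case 2
    then show ?thesis using right[of "v - n"] by simp
  qed (use left none in \<open>auto simp: nbrs_def bip_graph_def sym_graph_def\<close>)
qed

text \<open>Each left index is joined to \<open>d\<close> cyclically consecutive right indices,
  starting with its own.\<close>

definition circulant :: "nat \<Rightarrow> nat \<Rightarrow> nat pair_pre_digraph" where
  "circulant n d = bip_graph n (\<lambda>i j. \<exists>k<d. j = (i + k) mod n)"

lemma bipartite_graph_circulant: "bipartite_graph (circulant n d) {..<n} {n..<2 * n}"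
  unfolding circulant_def by (rule bipartite_graph_bip_graph)

lemma card_nbrs_circulant_left:
  assumes "i < n" "d \<le> n"
  shows "card (nbrs (circulant n d) i) = d"
proof -
  have "{j. j < n \<and> (\<exists>k<d. j = (i + k) mod n)} = (\<lambda>k. (i + k) mod n) ` {..<d}"
    using assms by auto
  \<comment> \<open>As \<open>d \<le> n\<close>, the shifts are distinct modulo
    \<open>n\<close>.\<close>
  moreover have "inj_on (\<lambda>k. (i + k) mod n) {..<d}"
    using assms by (intro inj_onI) (simp add: mod_if split: if_splits)
  ultimately show ?thesis
    using assms by (simp add: circulant_def nbrs_bip_graph_left card_image)
qed

text \<open>On the right, a neighbour is determined by the shift that produced the arc, and there
  are \<open>d\<close> shifts.\<close>

lemma card_nbrs_circulant_le:
  assumes "d \<le> n"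
  shows "card (nbrs (circulant n d) v) \<le> d"
proof (cases rule: bip_graph_vertex_cases[where v = v and n = n
      and R = "\<lambda>i j. \<exists>k<d. j = (i + k) mod n"])
  case left
  then show ?thesis using card_nbrs_circulant_left assms by simp
next
  case (right j)
  \<comment> \<open>Adding \<open>n - k\<close> undoes the shift; since \<open>k < n\<close>, the
    subtraction is not truncated.\<close>
  have "i = (j + (n - k)) mod n" if "i < n" "k < d" "j = (i + k) mod n" for i k
    using that assms mod_add_left_eq[of "i + k" n "n - k"] by simp
  then have "nbrs (circulant n d) v \<subseteq> (\<lambda>k. (j + (n - k)) mod n) ` {..<d}"
    using right by (auto simp: circulant_def nbrs_bip_graph_right)
  then have "card (nbrs (circulant n d) v) \<le> card {..<d}"
    by (rule surj_card_le[rotated]) simp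
  then show ?thesis by simp
next
  case none
  then show ?thesis by (simp add: circulant_def)
qed

lemma card_edges_circulant:
  assumes "d \<le> n"
  shows "card (edges (circulant n d)) = d * n"
proof -
  interpret bipartite_graph "circulant n d" "{..<n}" "{n..<2 * n}"
    by (rule bipartite_graph_circulant)
  show ?thesis using assms by (simp add: card_edges_eq_sum card_nbrs_circulant_left)
qed

text \<open>Shifts 0 and 1, available by \<open>2 \<le> d\<close>, give a zigzag from 0 through all
  left vertices; shift 0 then reaches the right ones.\<close>

lemma conn_circulant:
  assumes "2 \<le> d" "d \<le> n"
  shows "conn (circulant n d)"
proof -
  interpret bipartite_graph "circulant n d" "{..<n}" "{n..<2 * n}"
    by (rule bipartite_graph_circulant)
  let ?E = "parcs (circulant n d)"
  have diag: "(i, n + i) \<in> ?E" if "i < n" for i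
    using that assms unfolding circulant_def by (intro arc_bip_graph) (auto intro!: exI[of _ 0])
  \<comment> \<open>With \<open>Suc i < n\<close>, shift 1 does not wrap around.\<close>
  have off: "(i, n + Suc i) \<in> ?E" if "Suc i < n" for i
    using that assms unfolding circulant_def by (intro arc_bip_graph) (auto intro!: exI[of _ 1])
  have left: "(0, i) \<in> ?E\<^sup>*" if "i < n" for i
    using that
  proof (induction i)
    case (Suc i)
    then have "(0, i) \<in> ?E\<^sup>*" by simp
    also have "(i, n + Suc i) \<in> ?E" using off Suc by simp
    also have "(n + Suc i, Suc i) \<in> ?E" using arcs_symmetric[OF diag[of "Suc i"]] Suc by simp
    finally show ?case .
  qed simp
  have "(0, v) \<in> ?E\<^sup>*" if "v < 2 * n" for v
  proof (cases "v < n")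
    case False
    then have "v - n < n" "v = n + (v - n)" using that by auto
    then show ?thesis using left diag by (metis rtrancl.rtrancl_into_rtrancl)
  qed (use left in simp)
  moreover have "sym (?E\<^sup>*)"
    using arcs_symmetric by (intro sym_rtrancl symI)
  ultimately have "(u, v) \<in> ?E\<^sup>*" if "u < 2 * n" "v < 2 * n" for u v
    using that by (meson symD rtrancl_trans)
  moreover have "pverts (circulant n d) = {..<2 * n}"
    by (simp add: circulant_def bip_graph_def sym_graph_def)
  ultimately show ?thesis using assms by (auto simp: conn_iff lessThan_empty_iff)
qed

text \<open>Two disjoint stars, each centred at vertex 0 of one part and covering the rest of the other part.\<close>

definition two_stars :: "nat \<Rightarrow> nat pair_pre_digraph" where
  "two_stars n = bip_graph n (\<lambda>i j. (i = 0) \<noteq> (j = 0))"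

lemma bipartite_graph_two_stars: "bipartite_graph (two_stars n) {..<n} {n..<2 * n}"
  unfolding two_stars_def by (rule bipartite_graph_bip_graph)

lemma card_edges_two_stars:
  assumes "n \<ge> 1"
  shows "card (edges (two_stars n)) = 2 * n - 2"
proof -
  interpret bipartite_graph "two_stars n" "{..<n}" "{n..<2 * n}"
    by (rule bipartite_graph_two_stars)
  have "{j. j < n \<and> 0 < j} = {1..<n}" by auto
  then have "card (nbrs (two_stars n) 0) = n - 1"
    using assms by (simp add: two_stars_def nbrs_bip_graph_left card_image)
  moreover have "card (nbrs (two_stars n) i) = 1" if "i \<in> {1..<n}" for i
  proof -
    have "{j. j < n \<and> j = 0} = {0}" using assms by auto
    then show ?thesis using that by (simp add: two_stars_def nbrs_bip_graph_left)
  qed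
  moreover have "{..<n} = insert 0 {1..<n}" using assms by auto
  ultimately show ?thesis by (simp add: card_edges_eq_sum)
qed

text \<open>Only the centres 0 and \<open>n\<close> can have degree above 1, and every walk of two
  steps from a centre returns to it.\<close>

lemma two_stars_spider_1_free: "\<not> contains_copy (spider_graph 1) (two_stars n)"
proof -
  interpret bipartite_graph "two_stars n" "{..<n}" "{n..<2 * n}"
    by (rule bipartite_graph_two_stars)
  have "card (nbrs (two_stars n) v) \<le> 1" if "v \<noteq> 0" "v \<noteq> n" for v
  proof -
    \<comment> \<open>The only possible neighbour is the centre on the other side.\<close>
    have "nbrs (two_stars n) v \<subseteq> {if v < n then n else 0}"
      using that by (auto simp: nbrs_def two_stars_def bip_graph_def sym_graph_def)
    then show ?thesis by (metis card.empty card_mono finite.emptyI finite.insertI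
      card_insert_disjoint empty_iff One_nat_def)
  qed
  moreover have "x = v" if "v = 0 \<or> v = n" "(v, w) \<in> parcs (two_stars n)" "(w, x) \<in> parcs (two_stars n)"
    for v w x
    using that by (auto simp: two_stars_def bip_graph_def sym_graph_def)
  ultimately show ?thesis unfolding contains_spider_iff by (meson not_le)
qed

section \<open>Extremal numbers\<close>

text \<open>The bound \<open>k\<close> also makes the set of edge counts finite, as
  \<open>Max\<close> requires.\<close>

lemma max_edges_eqI:
  assumes "\<And>G. G \<in> \<G> \<Longrightarrow> card (edges G) \<le> k" "G \<in> \<G>" "card (edges G) = k"
  shows "max_edges \<G> = Some k"
proof -
  have "finite ((\<lambda>G. card (edges G)) ` \<G>)"
    by (rule finite_subset[of _ "{..k}"]) (use assms in auto)
  then have "Max ((\<lambda>G. card (edges G)) ` \<G>) = k"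
    using assms by (intro Max_eqI) auto
  then show ?thesis using assms(2) by (auto simp: max_edges_def)
qed

lemma card_edges_le_of_star_free:
  assumes "balanced_bipartite n G" "\<not> contains_copy (star_graph (d + 1)) G"
  shows "card (edges G) \<le> d * n"
proof -
  obtain X Y where XY: "bipartite_graph G X Y" "card X = n"
    using assms(1) unfolding balanced_bipartite_iff by blast
  interpret bipartite_graph G X Y by (rule XY)
  show ?thesis
    using assms(2) card_edges_le_of_degree_le[of d] XY(2)
    by (auto simp: contains_star_iff not_le less_Suc_eq_le)
qed

lemma circulant_star_free:
  assumes "d \<le> n"
  shows "\<not> contains_copy (star_graph (d + 1)) (circulant n d)"
proof -
  interpret bipartite_graph "circulant n d" "{..<n}" "{n..<2 * n}"
    by (rule bipartite_graph_circulant)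
  show ?thesis
    using card_nbrs_circulant_le[OF assms] by (auto simp: contains_star_iff not_le less_Suc_eq_le)
qed

lemma circulant_spider_free:
  assumes "d \<le> n"
  shows "\<not> contains_copy (spider_graph d) (circulant n d)"
proof -
  interpret bipartite_graph "circulant n d" "{..<n}" "{n..<2 * n}"
    by (rule bipartite_graph_circulant)
  show ?thesis
    using card_nbrs_circulant_le[OF assms] by (auto simp: contains_spider_iff not_less)
qed

lemma balanced_bipartite_circulant: "balanced_bipartite n (circulant n d)"
  unfolding circulant_def by (rule balanced_bipartite_bip_graph)

text \<open>This includes \<open>d = 1\<close>, where the circulant is a perfect matching; that case
  yields the value for \<open>path_graph 3\<close>.\<close>

lemma ex_b_star:
  assumes "d \<le> n"
  shows "ex_b n (star_graph (d + 1)) = Some (d * n)"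
  unfolding ex_b_def
  using card_edges_le_of_star_free circulant_star_free[OF assms] balanced_bipartite_circulant
    card_edges_circulant[OF assms]
  by (intro max_edges_eqI[where G = "circulant n d"]) blast+

lemma ex_bc_star:
  assumes "2 \<le> d" "d \<le> n"
  shows "ex_bc n (star_graph (d + 1)) = Some (d * n)"
  unfolding ex_bc_def
  using card_edges_le_of_star_free circulant_star_free[OF assms(2)] balanced_bipartite_circulant
    card_edges_circulant[OF assms(2)] conn_circulant[OF assms]
  by (intro max_edges_eqI[where G = "circulant n d"]) blast+

lemma ex_b_spider:
  assumes "2 \<le> d" "d \<le> n"
  shows "ex_b n (spider_graph d) = Some (d * n)"
  unfolding ex_b_def
  using bipartite_graph.card_edges_le_of_spider_free[OF _ assms(1)] balanced_bipartite_iff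
    circulant_spider_free[OF assms(2)] balanced_bipartite_circulant card_edges_circulant[OF assms(2)]
  by (intro max_edges_eqI[where G = "circulant n d"]) blast+

lemma ex_bc_spider:
  assumes "2 \<le> d" "d \<le> n"
  shows "ex_bc n (spider_graph d) = Some (d * n)"
  unfolding ex_bc_def
  using bipartite_graph.card_edges_le_of_spider_free[OF _ assms(1)] balanced_bipartite_iff
    circulant_spider_free[OF assms(2)] balanced_bipartite_circulant card_edges_circulant[OF assms(2)]
    conn_circulant[OF assms]
  by (intro max_edges_eqI[where G = "circulant n d"]) blast+

lemma ex_b_spider_1:
  assumes "n \<ge> 2"
  shows "ex_b n (spider_graph 1) = Some (2 * n - 2)"
  unfolding ex_b_def
proof (rule max_edges_eqI)
  show "two_stars n \<in> {G. balanced_bipartite n G \<and> \<not> contains_copy (spider_graph 1) G}"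
    using two_stars_spider_1_free by (simp add: two_stars_def balanced_bipartite_bip_graph)
  show "card (edges (two_stars n)) = 2 * n - 2"
    using assms by (simp add: card_edges_two_stars)
  show "card (edges G) \<le> 2 * n - 2"
    if "G \<in> {G. balanced_bipartite n G \<and> \<not> contains_copy (spider_graph 1) G}" for G :: "nat pair_pre_digraph"
    using that bipartite_graph.card_edges_le_of_spider_1_free[OF _ _ _ assms]
    unfolding balanced_bipartite_iff by blast
qed

section \<open>The case d = 1: paths on three and four vertices\<close>

lemma contains_path_graph_iff:
  assumes "balanced_bipartite n G"
  shows "contains_copy (path_graph 3) G \<longleftrightarrow> contains_copy (star_graph 2) G"
    and "contains_copy (path_graph 4) G \<longleftrightarrow> contains_copy (spider_graph 1) G"
proof -
  interpret pair_graph G using assms by (simp add: balanced_bipartite_def)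
  show "contains_copy (path_graph 3) G \<longleftrightarrow> contains_copy (star_graph 2) G"
    using contains_copy_iso[OF star_graph_2_iso_path_graph_3 pair_wf_digraph_star_graph
        pair_wf_digraph_path_graph pair_wf_digraph] by simp
  show "contains_copy (path_graph 4) G \<longleftrightarrow> contains_copy (spider_graph 1) G"
    using contains_copy_iso[OF spider_graph_1_iso_path_graph_4 pair_wf_digraph_spider_graph
        pair_wf_digraph_path_graph pair_wf_digraph] by simp
qed

lemma conn_contains_path_graph:
  assumes "balanced_bipartite n G" "conn G" "n \<ge> 2"
  shows "contains_copy (path_graph 3) G" and "contains_copy (path_graph 4) G"
proof -
  obtain X Y where XY: "bipartite_graph G X Y" "card X = n" "card Y = n"
    using assms(1) unfolding balanced_bipartite_iff by blast
  interpret bipartite_graph G X Y by (rule XY)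
  have spider: "contains_copy (spider_graph 1) G"
    using conn_contains_spider_1[OF XY(2,3) assms(3,2)] .
  \<comment> \<open>The centre of the spider has degree at least 2.\<close>
  then have "\<exists>v. 2 \<le> card (nbrs G v)"
    unfolding contains_spider_iff by (metis Suc_1 Suc_leI)
  then show "contains_copy (path_graph 3) G"
    using contains_path_graph_iff(1)[OF assms(1)] by (simp add: contains_star_iff)
  show "contains_copy (path_graph 4) G"
    using contains_path_graph_iff(2)[OF assms(1)] spider by simp
qed

lemma ex_b_path_graph_3:
  assumes "n \<ge> 1"
  shows "ex_b n (path_graph 3) = Some n"
proof -
  have "ex_b n (path_graph 3) = ex_b n (star_graph 2)"
    unfolding ex_b_def using contains_path_graph_iff(1) by (metis (no_types, lifting))
  then show ?thesis using ex_b_star[of 1 n] assms by (simp add: numeral_2_eq_2)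
qed

lemma ex_b_path_graph_4:
  assumes "n \<ge> 2"
  shows "ex_b n (path_graph 4) = Some (2 * n - 2)"
proof -
  have "ex_b n (path_graph 4) = ex_b n (spider_graph 1)"
    unfolding ex_b_def using contains_path_graph_iff(2) by (metis (no_types, lifting))
  then show ?thesis using ex_b_spider_1[OF assms] by simp
qed

lemma ex_bc_path_graph:
  assumes "n \<ge> 2"
  shows "ex_bc n (path_graph 3) = None" and "ex_bc n (path_graph 4) = None"
  using conn_contains_path_graph[OF _ _ assms] by (auto simp: ex_bc_def max_edges_def)

text \<open>The isomorphisms justify treating d = 1 through paths. The value \<open>None\<close>
  concerns graphs on natural numbers; the last conjunct gives nonexistence over an arbitrary vertex
  type.\<close>

theorem proposition5:
  shows "(\<forall>d\<ge>2. \<forall>F \<in> {star_graph (d + 1), spider_graph d}. \<forall>n \<ge> card (pverts F).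
            ex_b n F = Some (d * n) \<and> ex_bc n F = Some (d * n))
       \<and> digraph_iso (with_proj (star_graph 2)) (with_proj (path_graph 3))
       \<and> digraph_iso (with_proj (spider_graph 1)) (with_proj (path_graph 4))
       \<and> (\<forall>n\<ge>2. ex_b n (path_graph 3) = Some n \<and> ex_b n (path_graph 4) = Some (2 * n - 2)
            \<and> ex_bc n (path_graph 3) = None \<and> ex_bc n (path_graph 4) = None)
       \<and> (\<forall>n\<ge>2. \<forall>F \<in> {path_graph 3, path_graph 4}.
            \<not> (\<exists>G :: 'a pair_pre_digraph.
                  balanced_bipartite n G \<and> conn G \<and> \<not> contains_copy F G))"
proof (intro conjI allI impI ballI)
  fix d F n
  assume d: "2 \<le> d" and F: "F \<in> {star_graph (d + 1), spider_graph d}" and n: "card (pverts F) \<le> n"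
  \<comment> \<open>The two forbidden graphs have \<open>d + 2\<close> and \<open>d + 3\<close>
    vertices.\<close>
  have "d \<le> n"
    using F n card_pverts_star_graph[of "d + 1"] card_pverts_spider_graph[of d] by auto
  with d F show "ex_b n F = Some (d * n)" "ex_bc n F = Some (d * n)"
    using ex_b_star ex_bc_star ex_b_spider ex_bc_spider by blast+
next
  fix n :: nat and F
  assume "2 \<le> n" "F \<in> {path_graph 3, path_graph 4}"
  then show "\<nexists>G :: 'a pair_pre_digraph. balanced_bipartite n G \<and> conn G \<and> \<not> contains_copy F G"
    using conn_contains_path_graph by blast
qed (use star_graph_2_iso_path_graph_3 spider_graph_1_iso_path_graph_4 ex_b_path_graph_3
    ex_b_path_graph_4 ex_bc_path_graph in simp_all)

end
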